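(* Let $V=\{a_1,b_1,a_2,b_2,a_3,b_3\}$ (six distinct elements), $\mathcal{E}_2=\binom{V}{3}\setminus\{\{a_1,b_2,b_3\},\{a_2,b_1,b_3\},\{a_3,b_1,b_2\},\{a_1,a_2,a_3\}\}$ and $\mathcal{E}_3=\binom{V}{3}\setminus\{\{a_1,b_2,b_3\},\{a_2,b_1,b_3\},\{a_3,b_1,b_2\}\}$. Then both $\mathcal{F}_2=(V,\mathcal{E}_2)$ and $\mathcal{F}_3=(V,\mathcal{E}_3)$ are minimal non-metric hypergraphs: neither is metric, but every sub-hypergraph of either one induced by a proper subset of $V$ is metric.
   Context: $\binom{V}{3}$ denotes the set of three-element subsets of $V$. A $3$-uniform hypergraph $(V,\mathcal{E})$ is metric if there is a metric $\mathrm{dist}$ on $V$ such that $\mathcal{E}=\{\{u,v,w\}: u,v,w \text{ pairwise distinct and } \mathrm{dist}(u,v)+\mathrm{dist}(v,w)=\mathrm{dist}(u,w)\}$. For $W\subseteq V$, the sub-hypergraph induced by $W$ is $(W,\{E\in\mathcal{E}:E\subseteq W\})$. *)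

theory Defs
  imports "HOL-Analysis.Abstract_Metric_Spaces" "HOL-Library.Ramsey"
begin

text \<open>The pair consists of the vertex set and the set of hyperedges.\<close>

type_synonym 'a hypergraph = "'a set \<times> 'a set set"

definition three_uniform :: "'a hypergraph \<Rightarrow> bool" where
  "three_uniform H \<longleftrightarrow> snd H \<subseteq> nsets (fst H) 3"

definition collinear_triples :: "'a set \<Rightarrow> ('a \<Rightarrow> 'a \<Rightarrow> real) \<Rightarrow> 'a set set" where
  "collinear_triples V d =
     {{u, v, w} | u v w. u \<in> V \<and> v \<in> V \<and> w \<in> V \<and> u \<noteq> v \<and> v \<noteq> w \<and> u \<noteq> w \<and>
        d u v + d v w = d u w}"

text \<open>\<^const>\<open>Metric_space\<close> asks for symmetry and nonnegativity on the whole type; this costs no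
  generality, since a metric on the vertex set can be extended by \<open>0\<close> elsewhere.\<close>

definition metric_hypergraph :: "'a hypergraph \<Rightarrow> bool" where
  "metric_hypergraph H \<longleftrightarrow>
     three_uniform H \<and>
     (\<exists>d. Metric_space (fst H) d \<and> snd H = collinear_triples (fst H) d)"

definition induced_subhypergraph :: "'a hypergraph \<Rightarrow> 'a set \<Rightarrow> 'a hypergraph" where
  "induced_subhypergraph H W = (W, {E \<in> snd H. E \<subseteq> W})"

definition minimal_non_metric :: "'a hypergraph \<Rightarrow> bool" where
  "minimal_non_metric H \<longleftrightarrow>
     three_uniform H \<and> \<not> metric_hypergraph H \<and>
     (\<forall>W. W \<subset> fst H \<longrightarrow> metric_hypergraph (induced_subhypergraph H W))"

end

theory Submission
  imports Defs
begin

text \<open>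
  Write \<open>xyz\<close> for ``\<open>y\<close> lies between \<open>x\<close> and \<open>z\<close>''; in a metric space, \<open>xyz\<close> and
  \<open>xzw\<close> imply \<open>xyw\<close> and \<open>yzw\<close>. This alone refutes metricity: \<open>b\<^sub>1b\<^sub>2b\<^sub>3\<close> is an edge, and by
  cyclic symmetry \<open>b\<^sub>2\<close> may be taken as its middle vertex. As \<open>a\<^sub>1b\<^sub>2b\<^sub>3\<close> and \<open>a\<^sub>3b\<^sub>1b\<^sub>2\<close> are not
  edges, this forces first \<open>b\<^sub>1a\<^sub>1b\<^sub>3\<close> and \<open>b\<^sub>1a\<^sub>3b\<^sub>3\<close>, then \<open>a\<^sub>1b\<^sub>1b\<^sub>2\<close> and \<open>b\<^sub>2b\<^sub>3a\<^sub>3\<close>, and these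
  leave no middle vertex for the edge \<open>a\<^sub>1a\<^sub>3b\<^sub>2\<close>.
  For minimality it suffices to delete a single vertex. What is left misses either a single triple
  or two triples sharing one vertex. The first is realised by the graph metric of \<open>K\<^sub>2\<^sub>,\<^sub>3\<close>, the
  second by a 4-cycle together with a vertex joined to two opposite vertices of the cycle
  by edges of length 2.
\<close>

definition between :: "('a \<Rightarrow> 'a \<Rightarrow> real) \<Rightarrow> 'a \<Rightarrow> 'a \<Rightarrow> 'a \<Rightarrow> bool" where
  "between d u v w \<longleftrightarrow> d u v + d v w = d u w"

text \<open>Each disjunct makes a different vertex the middle one; as betweenness in a metric space
  is symmetric in its ends, this covers all six orderings.\<close>

definition collinear3 :: "('a \<Rightarrow> 'a \<Rightarrow> real) \<Rightarrow> 'a \<Rightarrow> 'a \<Rightarrow> 'a \<Rightarrow> bool" where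
  "collinear3 d u v w \<longleftrightarrow> between d u v w \<or> between d v w u \<or> between d w u v"

lemma nsets_3_iff:
  "E \<in> nsets W 3 \<longleftrightarrow>
    (\<exists>u v w. E = {u, v, w} \<and> u \<in> W \<and> v \<in> W \<and> w \<in> W \<and> u \<noteq> v \<and> v \<noteq> w \<and> u \<noteq> w)"
  by (auto simp: nsets_def card_3_iff)

context Metric_space
begin

lemma between_sym: "between d u v w \<longleftrightarrow> between d w v u"
  by (auto simp: between_def commute add.commute)

text \<open>The hypotheses make \<open>d x w\<close> the length of the path \<open>x\<close>,
  \<open>y\<close>, \<open>z\<close>, \<open>w\<close>, so the two triangle inequalities along that
  path must be equalities.\<close>

lemma between_trans:
  assumes "between d x y z" "between d x z w" "x \<in> M" "y \<in> M" "z \<in> M" "w \<in> M"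
  shows "between d x y w" "between d y z w"
  using assms triangle[of x y w] triangle[of y z w] by (auto simp: between_def)

lemma collinear_triples_iff:
  assumes "u \<in> M" "v \<in> M" "w \<in> M" "u \<noteq> v" "v \<noteq> w" "u \<noteq> w"
  shows "{u, v, w} \<in> collinear_triples M d \<longleftrightarrow> collinear3 d u v w"
proof
  assume "{u, v, w} \<in> collinear_triples M d"
  then obtain x y z where eq: "{u, v, w} = {x, y, z}" and "x \<noteq> y" "y \<noteq> z" "x \<noteq> z"
    and bet: "between d x y z"
    by (auto simp: collinear_triples_def between_def)
  then have "x \<in> {u, v, w}" "y \<in> {u, v, w}" "z \<in> {u, v, w}"
    by auto
  with bet \<open>x \<noteq> y\<close> \<open>y \<noteq> z\<close> \<open>x \<noteq> z\<close> show "collinear3 d u v w"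
    unfolding collinear3_def by (auto simp: between_sym)
next
  have *: "{x, y, z} \<in> collinear_triples M d"
    if "between d x y z" "x \<in> M" "y \<in> M" "z \<in> M" "x \<noteq> y" "y \<noteq> z" "x \<noteq> z" for x y z
    using that by (auto simp: collinear_triples_def between_def)
  assume "collinear3 d u v w"
  then show "{u, v, w} \<in> collinear_triples M d"
    using *[of u v w] *[of v w u] *[of w u v] assms
    by (auto simp: collinear3_def insert_commute)
qed

lemma middle_contradiction:
  assumes M: "a1 \<in> M" "b1 \<in> M" "b2 \<in> M" "a3 \<in> M" "b3 \<in> M"
    and N: "\<not> collinear3 d a1 b2 b3" "\<not> collinear3 d a3 b1 b2"
    and E: "collinear3 d a1 b1 b2" "collinear3 d a1 b1 b3" "collinear3 d a3 b1 b3"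
      "collinear3 d a3 b2 b3" "collinear3 d a1 a3 b2"
  shows "\<not> between d b1 b2 b3"
proof
  assume b: "between d b1 b2 b3"
  have 1: "between d b1 a1 b3"
    using b N(1) E(2) M between_sym
      between_trans[of b3 b2 b1 a1]
      between_trans[of b1 b2 b3 a1]
    unfolding collinear3_def by blast
  have 2: "between d a1 b1 b2"
    using b 1 N(1) E(1) M between_sym
      between_trans[of b1 b2 a1 b3]
      between_trans[of b1 a1 b2 b3]
    unfolding collinear3_def by blast
  \<comment> \<open>Facts 3 and 4 mirror 1 and 2 under swapping the indices 1 and 3.\<close>
  have 3: "between d b1 a3 b3"
    using b N(2) E(3) M between_sym
      between_trans[of b1 b2 b3 a3]
      between_trans[of b3 b2 b1 a3]
    unfolding collinear3_def by blast
  have 4: "between d b2 b3 a3"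
    using b 3 N(2) E(4) M between_sym
      between_trans[of b3 b2 a3 b1]
      between_trans[of b3 a3 b2 b1]
    unfolding collinear3_def by blast
  \<comment> \<open>Middle vertex \<open>a1\<close> would give \<open>b2\<close>, \<open>b1\<close>,
    \<open>a3\<close> in this order, \<open>a3\<close> would give \<open>b2\<close>,
    \<open>b3\<close>, \<open>a1\<close>, and \<open>b2\<close> would give \<open>b1\<close>,
    \<open>b2\<close>, \<open>a3\<close>; all three are non-edges.\<close>
  show False
    using 2 4 N E(5) M between_sym
      between_trans[of b2 b1 a1 a3]
      between_trans[of b2 b3 a3 a1]
      between_trans[of a1 b1 b2 a3]
    unfolding collinear3_def by blast
qed

end

text \<open>Both sides have three elements. As a rewrite rule this replaces a comparison up to
  permutation by three membership tests.\<close>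

lemma triple_eq_iff_subset:
  assumes "distinct [u, v, w]" "distinct [p, q, r]"
  shows "{u, v, w} = {p, q, r} \<longleftrightarrow> {u, v, w} \<subseteq> {p, q, r}"
  using assms card_subset_eq[of "{p, q, r}" "{u, v, w}"] by auto

text \<open>The bounds on \<open>N\<close> leave the status of \<open>{a1, a2, a3}\<close> open, so
  one argument serves both hypergraphs.\<close>

lemma not_metric_hypergraph:
  assumes dist: "distinct [a1, b1, a2, b2, a3, b3]"
    and V: "V = {a1, b1, a2, b2, a3, b3}"
    and N: "{{a1, b2, b3}, {a2, b1, b3}, {a3, b1, b2}} \<subseteq> N"
      "N \<subseteq> {{a1, b2, b3}, {a2, b1, b3}, {a3, b1, b2}, {a1, a2, a3}}"
  shows "\<not> metric_hypergraph (V, nsets V 3 - N)"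
proof
  assume "metric_hypergraph (V, nsets V 3 - N)"
  then obtain d where d: "Metric_space V d" and eq: "nsets V 3 - N = collinear_triples V d"
    by (auto simp: metric_hypergraph_def)
  interpret Metric_space V d by fact
  have col: "collinear3 d u v w \<longleftrightarrow> {u, v, w} \<notin> N"
    if "u \<in> V" "v \<in> V" "w \<in> V" "u \<noteq> v" "v \<noteq> w" "u \<noteq> w" for u v w
  proof -
    have "{u, v, w} \<in> nsets V 3"
      using that unfolding nsets_3_iff by blast
    then show ?thesis
      using collinear_triples_iff[OF that] by (auto simp flip: eq)
  qed
  have edge: "collinear3 d u v w"
    if "u \<in> V" "v \<in> V" "w \<in> V" "u \<noteq> v" "v \<noteq> w" "u \<noteq> w"
      "{u, v, w} \<notin> {{a1, b2, b3}, {a2, b1, b3}, {a3, b1, b2}, {a1, a2, a3}}" for u v w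
    unfolding col[OF that(1-6)] using N(2) that(7) by (rule contra_subsetD)
  have non_edge: "\<not> collinear3 d u v w"
    if "u \<in> V" "v \<in> V" "w \<in> V" "u \<noteq> v" "v \<noteq> w" "u \<noteq> w"
      "{u, v, w} \<in> {{a1, b2, b3}, {a2, b1, b3}, {a3, b1, b2}}" for u v w
    unfolding col[OF that(1-6)] not_not using N(1) that(7) by (rule subsetD)
  \<comment> \<open>The reversed list gives the simplifier every inequation in its other
    orientation.\<close>
  have "distinct [b3, a3, b2, a2, b1, a1]"
    using dist by auto
  note facts = dist[simplified] this[simplified] V triple_eq_iff_subset
  have "\<not> between d b1 b2 b3"
    by (rule middle_contradiction[of a1 b1 b2 a3 b3]; (rule edge non_edge)?; simp add: facts)
  moreover have "\<not> between d b2 b3 b1"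
    by (rule middle_contradiction[of a2 b2 b3 a1 b1]; (rule edge non_edge)?; simp add: facts)
  moreover have "\<not> between d b3 b1 b2"
    by (rule middle_contradiction[of a3 b3 b1 a2 b2]; (rule edge non_edge)?; simp add: facts)
  moreover have "collinear3 d b1 b2 b3"
    by (rule edge; simp add: facts)
  ultimately show False
    by (auto simp: collinear3_def)
qed

lemma metric_hypergraph_nsets_Diff:
  assumes "Metric_space W d"
    and "\<And>u v w. u \<in> W \<Longrightarrow> v \<in> W \<Longrightarrow> w \<in> W \<Longrightarrow> u \<noteq> v \<Longrightarrow> v \<noteq> w \<Longrightarrow> u \<noteq> w \<Longrightarrow>
      collinear3 d u v w \<longleftrightarrow> {u, v, w} \<notin> N"
  shows "metric_hypergraph (W, nsets W 3 - N)"
proof -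
  interpret Metric_space W d by fact
  have "E \<in> collinear_triples W d \<longleftrightarrow> E \<in> nsets W 3 \<and> E \<notin> N" for E
  proof (cases "E \<in> nsets W 3")
    case True
    then show ?thesis
      using assms(2) collinear_triples_iff unfolding nsets_3_iff by metis
  next
    case False
    then show ?thesis
      unfolding collinear_triples_def nsets_3_iff by blast
  qed
  then have "nsets W 3 - N = collinear_triples W d"
    by auto
  then show ?thesis
    using assms(1) by (auto simp: metric_hypergraph_def three_uniform_def)
qed

text \<open>The same distance function works on \<open>W\<close>: whether a triple is collinear
  depends only on its own three distances.\<close>

lemma metric_hypergraph_induced_subhypergraph:
  assumes "metric_hypergraph H" "W \<subseteq> fst H"
  shows "metric_hypergraph (induced_subhypergraph H W)"
proof -
  obtain d where H: "snd H \<subseteq> nsets (fst H) 3" "Metric_space (fst H) d"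
    and E: "snd H = collinear_triples (fst H) d"
    using assms(1) by (auto simp: metric_hypergraph_def three_uniform_def)
  have "{E \<in> snd H. E \<subseteq> W} = collinear_triples W d"
    using assms(2) unfolding E collinear_triples_def by blast
  moreover have "{E \<in> snd H. E \<subseteq> W} \<subseteq> nsets W 3"
    using H(1) by (auto simp: nsets_def)
  moreover have "Metric_space W d"
    using H(2) assms(2) by (rule Metric_space.subspace)
  ultimately show ?thesis
    by (auto simp: metric_hypergraph_def three_uniform_def induced_subhypergraph_def)
qed

lemma metric_hypergraph_one_missing:
  assumes "distinct [p, q, r, s, t]"
  shows "metric_hypergraph ({p, q, r, s, t}, nsets {p, q, r, s, t} 3 - {{p, q, r}})"
proof -
  \<comment> \<open>The parts of the complete bipartite graph are \<open>{p, q, r}\<close> and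
    \<open>{s, t}\<close>. A triple meeting both has distances 1, 1, 2; one inside a part has 2, 2,
    2.\<close>
  define d :: "'a \<Rightarrow> 'a \<Rightarrow> real" where
    "d u v = (if u = v then 0 else if u \<in> {s, t} \<longleftrightarrow> v \<in> {s, t} then 2 else 1)" for u v
  have "Metric_space {p, q, r, s, t} d"
    by unfold_locales (auto simp: d_def)
  then show ?thesis
  proof (rule metric_hypergraph_nsets_Diff)
    fix u v w
    assume "u \<in> {p, q, r, s, t}" "v \<in> {p, q, r, s, t}" "w \<in> {p, q, r, s, t}"
      and "u \<noteq> v" "v \<noteq> w" "u \<noteq> w"
    \<comment> \<open>Without \<open>insert_iff\<close>, membership in \<open>{s, t}\<close> stays
      atomic and only the part of each vertex is split on.\<close>
    moreover from this have "collinear3 d u v w \<longleftrightarrow>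
        \<not> ((u \<in> {s, t} \<longleftrightarrow> v \<in> {s, t}) \<and> (v \<in> {s, t} \<longleftrightarrow> w \<in> {s, t}))"
      by (simp add: collinear3_def between_def d_def del: insert_iff)
    ultimately show "collinear3 d u v w \<longleftrightarrow> {u, v, w} \<notin> {{p, q, r}}"
      using assms by (auto simp: triple_eq_iff_subset)
  qed
qed

lemma metric_hypergraph_two_missing:
  assumes "distinct [x, p, q, r, s]"
  shows "metric_hypergraph ({x, p, q, r, s}, nsets {x, p, q, r, s} 3 - {{x, p, q}, {x, r, s}})"
proof -
  \<comment> \<open>The 4-cycle has opposite pairs \<open>{p, q}\<close> and \<open>{r, s}\<close>;
    \<open>x\<close> has distance 2 from the first pair and 3 from the second. Triples through
    \<open>x\<close> have distances 2, 1, 3 if they meet both pairs, and otherwise 2, 2, 2 or 3, 3,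
    2.\<close>
  define d :: "'a \<Rightarrow> 'a \<Rightarrow> real" where
    "d u v = (if u = v then 0 else if x \<in> {u, v} \<and> (u \<in> {r, s} \<or> v \<in> {r, s}) then 3
      else if x \<in> {u, v} \<or> (u \<in> {r, s} \<longleftrightarrow> v \<in> {r, s}) then 2 else 1)" for u v
  have "Metric_space {x, p, q, r, s} d"
    by unfold_locales (use assms in \<open>auto simp: d_def\<close>)
  then show ?thesis
  proof (rule metric_hypergraph_nsets_Diff)
    fix u v w
    assume "u \<in> {x, p, q, r, s}" "v \<in> {x, p, q, r, s}" "w \<in> {x, p, q, r, s}"
      and "u \<noteq> v" "v \<noteq> w" "u \<noteq> w"
    moreover from this have "collinear3 d u v w \<longleftrightarrow> x \<notin> {u, v, w} \<or>
        (if u = x then v \<in> {r, s} \<longleftrightarrow> w \<notin> {r, s}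
         else if v = x then u \<in> {r, s} \<longleftrightarrow> w \<notin> {r, s}
         else u \<in> {r, s} \<longleftrightarrow> v \<notin> {r, s})"
      using assms by (auto simp: collinear3_def between_def d_def)
    ultimately show "collinear3 d u v w \<longleftrightarrow> {u, v, w} \<notin> {{x, p, q}, {x, r, s}}"
      using assms by (auto simp: triple_eq_iff_subset)
  qed
qed

lemma induced_subhypergraph_delete:
  "induced_subhypergraph (V, nsets V 3 - N) (V - {y}) =
    (V - {y}, nsets (V - {y}) 3 - {E \<in> N. y \<notin> E})"
  by (auto simp: induced_subhypergraph_def nsets_def)

lemma metric_hypergraph_delete_one_missing:
  assumes dist: "distinct [y, p, q, r, s, t]" and V: "V = {y, p, q, r, s, t}"
    and N: "{E \<in> N. y \<notin> E} = {{p, q, r}}"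
  shows "metric_hypergraph (induced_subhypergraph (V, nsets V 3 - N) (V - {y}))"
proof -
  have V_y: "V - {y} = {p, q, r, s, t}"
    using dist V by auto
  have "distinct [p, q, r, s, t]"
    using dist by simp
  then show ?thesis
    unfolding induced_subhypergraph_delete N unfolding V_y by (rule metric_hypergraph_one_missing)
qed

lemma metric_hypergraph_delete_two_missing:
  assumes dist: "distinct [y, x, p, q, r, s]" and V: "V = {y, x, p, q, r, s}"
    and N: "{E \<in> N. y \<notin> E} = {{x, p, q}, {x, r, s}}"
  shows "metric_hypergraph (induced_subhypergraph (V, nsets V 3 - N) (V - {y}))"
proof -
  have V_y: "V - {y} = {x, p, q, r, s}"
    using dist V by auto
  have "distinct [x, p, q, r, s]"
    using dist by simp
  then show ?thesis
    unfolding induced_subhypergraph_delete N unfolding V_y by (rule metric_hypergraph_two_missing)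
qed

lemma minimal_non_metricI:
  assumes "three_uniform H" "\<not> metric_hypergraph H"
    and delete: "\<And>y. y \<in> fst H \<Longrightarrow> metric_hypergraph (induced_subhypergraph H (fst H - {y}))"
  shows "minimal_non_metric H"
  unfolding minimal_non_metric_def
proof (intro conjI allI impI)
  fix W
  assume "W \<subset> fst H"
  then obtain y where y: "y \<in> fst H" "W \<subseteq> fst H - {y}"
    by blast
  then have "metric_hypergraph
      (induced_subhypergraph (induced_subhypergraph H (fst H - {y})) W)"
    by (intro metric_hypergraph_induced_subhypergraph delete)
      (simp_all add: induced_subhypergraph_def)
  moreover have "induced_subhypergraph (induced_subhypergraph H (fst H - {y})) W =
      induced_subhypergraph H W"
    using y(2) by (auto simp: induced_subhypergraph_def)
  ultimately show "metric_hypergraph (induced_subhypergraph H W)"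
    by simp
qed (use assms in auto)

theorem theorem4:
  fixes a1 b1 a2 b2 a3 b3 :: 'a
    and V :: "'a set" and E2 E3 :: "'a set set"
  assumes "distinct [a1, b1, a2, b2, a3, b3]"
    and "V = {a1, b1, a2, b2, a3, b3}"
    and "E2 = nsets V 3 - {{a1, b2, b3}, {a2, b1, b3}, {a3, b1, b2}, {a1, a2, a3}}"
    and "E3 = nsets V 3 - {{a1, b2, b3}, {a2, b1, b3}, {a3, b1, b2}}"
  shows "minimal_non_metric (V, E2) \<and> minimal_non_metric (V, E3)"
proof
  note two = metric_hypergraph_delete_two_missing and one = metric_hypergraph_delete_one_missing
  show "minimal_non_metric (V, E2)"
    unfolding assms(3)
  proof (rule minimal_non_metricI, unfold fst_conv)
    let ?N = "{{a1, b2, b3}, {a2, b1, b3}, {a3, b1, b2}, {a1, a2, a3}}"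
    let ?H = "(V, nsets V 3 - ?N)"
    show "three_uniform ?H"
      by (auto simp: three_uniform_def)
    show "\<not> metric_hypergraph ?H"
      by (rule not_metric_hypergraph[OF assms(1,2)]) auto
    \<comment> \<open>The four missing triples form a Pasch configuration: each vertex lies in
      exactly two, and any two share exactly one vertex. Deleting a vertex thus leaves two of them,
      and their common vertex instantiates \<open>x\<close>.\<close>
    have "metric_hypergraph (induced_subhypergraph ?H (V - {a1}))"
      by (rule two[of a1 b1 a2 b3 a3 b2]) (use assms(1,2) in auto)
    moreover have "metric_hypergraph (induced_subhypergraph ?H (V - {a2}))"
      by (rule two[of a2 b2 a1 b3 a3 b1]) (use assms(1,2) in auto)
    moreover have "metric_hypergraph (induced_subhypergraph ?H (V - {a3}))"
      by (rule two[of a3 b3 a1 b2 a2 b1]) (use assms(1,2) in auto)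
    moreover have "metric_hypergraph (induced_subhypergraph ?H (V - {b1}))"
      by (rule two[of b1 a1 b2 b3 a2 a3]) (use assms(1,2) in auto)
    moreover have "metric_hypergraph (induced_subhypergraph ?H (V - {b2}))"
      by (rule two[of b2 a2 b1 b3 a1 a3]) (use assms(1,2) in auto)
    moreover have "metric_hypergraph (induced_subhypergraph ?H (V - {b3}))"
      by (rule two[of b3 a3 b1 b2 a1 a2]) (use assms(1,2) in auto)
    ultimately show "metric_hypergraph (induced_subhypergraph ?H (V - {y}))" if "y \<in> V" for y
      using that assms(2) by blast
  qed
  show "minimal_non_metric (V, E3)"
    unfolding assms(4)
  proof (rule minimal_non_metricI, unfold fst_conv)
    let ?N = "{{a1, b2, b3}, {a2, b1, b3}, {a3, b1, b2}}"
    let ?H = "(V, nsets V 3 - ?N)"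
    show "three_uniform ?H"
      by (auto simp: three_uniform_def)
    show "\<not> metric_hypergraph ?H"
      by (rule not_metric_hypergraph[OF assms(1,2)]) auto
    have "metric_hypergraph (induced_subhypergraph ?H (V - {a1}))"
      by (rule two[of a1 b1 a2 b3 a3 b2]) (use assms(1,2) in auto)
    moreover have "metric_hypergraph (induced_subhypergraph ?H (V - {a2}))"
      by (rule two[of a2 b2 a1 b3 a3 b1]) (use assms(1,2) in auto)
    moreover have "metric_hypergraph (induced_subhypergraph ?H (V - {a3}))"
      by (rule two[of a3 b3 a1 b2 a2 b1]) (use assms(1,2) in auto)
    \<comment> \<open>Each \<open>b\<close> vertex lies in two of the three missing triples, so only
      one survives its deletion.\<close>
    moreover have "metric_hypergraph (induced_subhypergraph ?H (V - {b1}))"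
      by (rule one[of b1 a1 b2 b3 a2 a3]) (use assms(1,2) in auto)
    moreover have "metric_hypergraph (induced_subhypergraph ?H (V - {b2}))"
      by (rule one[of b2 a2 b1 b3 a1 a3]) (use assms(1,2) in auto)
    moreover have "metric_hypergraph (induced_subhypergraph ?H (V - {b3}))"
      by (rule one[of b3 a3 b1 b2 a1 a2]) (use assms(1,2) in auto)
    ultimately show "metric_hypergraph (induced_subhypergraph ?H (V - {y}))" if "y \<in> V" for y
      using that assms(2) by blast
  qed
qed

end
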